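(* Let $n\ge2$, let $\rho$ be a real-analytic function on an open set $\widetilde\Omega\subset\mathbb{R}^{2n}$, and let $\mathcal{A}=(\alpha_{j,j'})_{1\le j,j'\le 2n}$ be the constant matrix with $\alpha_{2i-1,2i}=-1$, $\alpha_{2i,2i-1}=1$ for $1\le i\le n$ and all other entries $0$ (the complex case). Let all objects in the context ($D$, $\mathfrak{D}_0$, the torsion coefficients $c^k_{1,2}$) be formed from $\rho$ and this $\mathcal{A}$. Then at every point of $M$ at which $D=-(\rho_1^2+\rho_2^2)\neq0$ one has $\mathfrak{D}_0=0$, and the torsion can be absorbed if $$c^1_{1,2}=c^2_{1,2}=0.$$
   Context: The problem behind these objects is the existence of holomorphic maps $f$ from an open set $\Omega\subset\mathbb{R}^2=\mathbb{C}$ to $\widetilde\Omega\subset\mathbb{R}^{2n}=\mathbb{C}^n$ with $\rho(f(x))=0$; holomorphy is the equation $\partial f/\partial x_2=\mathcal{A}\,\partial f/\partial x_1$. Functions on $\widetilde\Omega$ are evaluated at $f=(f_1,\dots,f_{2n})$. Write $\rho_j=\partial\rho/\partial y_j$, let $\alpha^{(2)}_{j,i}$ be the entries of $\mathcal{A}^2$, and for $1\le i\le 2n$ put $$\mu_i=\sum_{j=1}^{2n}\rho_j\alpha_{j,i},\qquad \mu^{(2)}_i=\sum_{j=1}^{2n}\rho_j\alpha^{(2)}_{j,i}.$$ Put $D=\rho_1\mu_2-\rho_2\mu_1$, which here equals $-(\rho_1^2+\rho_2^2)$ and is assumed nonzero. For $3\le i\le 2n$ and $1\le j\le 2n$ put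 $$\gamma^1_i=-\tfrac1D(\rho_i\mu_2-\rho_2\mu_i),\qquad \gamma^2_i=-\tfrac1D(\rho_1\mu_i-\rho_i\mu_1),\qquad \beta_{j,i}=\alpha_{j,1}\gamma^1_i+\alpha_{j,2}\gamma^2_i+\alpha_{j,i}.$$ Let $\mathfrak{D}_0=(\mathfrak{D}_{0,3},\dots,\mathfrak{D}_{0,2n})$ be the row vector with $$\mathfrak{D}_{0,i}=-\frac1{D^2}\Big\{\rho_1\big[\mu_i\mu^{(2)}_2-\mu_2\mu^{(2)}_i\big]+\rho_2\big[\mu_1\mu^{(2)}_i-\mu_i\mu^{(2)}_1\big]+\rho_i\big[\mu_2\mu^{(2)}_1-\mu_1\mu^{(2)}_2\big]\Big\}.$$ Let $M$ be the space with coordinates $(x_1,x_2,f_1,\dots,f_{2n},p^3_1,\dots,p^{2n}_1)$, with $(x_1,x_2)\in\Omega$, $f\in\widetilde\Omega$, $p^j_1\in\mathbb{R}$ (where $D\neq0$). On $M$ consider the 1-forms $$\theta^1=df_1-\sum_{j=3}^{2n}\gamma^1_jp^j_1dx_1-\sum_{j=3}^{2n}\beta_{1,j}p^j_1dx_2,\qquad \theta^2=df_2-\sum_{j=3}^{2n}\gamma^2_jp^j_1dx_1-\sum_{j=3}^{2n}\beta_{2,j}p^j_1dx_2,$$ $$\theta^i=df_i-p^i_1dx_1-\sum_{j=3}^{2n}\beta_{i,j}p^j_1dx_2\qquad(3\le i\le 2n).$$ Modulo the algebraic ideal generated by $\theta^1,\dots,\theta^{2n}$, each $d\theta^k$ is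 uniquely a combination of the forms $dp^j_1\wedge dx_1$, $dp^j_1\wedge dx_2$ ($3\le j\le 2n$) and $dx_1\wedge dx_2$; $c^k_{1,2}$ denotes the coefficient of $dx_1\wedge dx_2$. The torsion can be absorbed at a point of $M$ if there exist real numbers $v^i_1,v^i_2$ ($3\le i\le 2n$) such that at that point $$\sum_{i=3}^{2n}\big(\gamma^1_iv^i_2-\beta_{1,i}v^i_1\big)=c^1_{1,2},\qquad \sum_{i=3}^{2n}\big(\gamma^2_iv^i_2-\beta_{2,i}v^i_1\big)=c^2_{1,2},\qquad v^j_2-\sum_{i=3}^{2n}\beta_{j,i}v^i_1=c^j_{1,2}\quad(3\le j\le 2n).$$ *)

theory Defs
  imports "HOL-Analysis.Analysis"
begin

text \<open>
  Points of \<open>\<real>\<^sup>I\<close>, for a finite index set \<open>I\<close>, are the functions in \<open>extensional I\<close>, with the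
  topology \<^term>\<open>powertop_real I\<close>; thus \<open>\<real>\<^sup>2\<^sup>n\<close> is the case \<open>I = {1..2*n}\<close>, and the index
  conventions \<open>1 \<le> i \<le> 2n\<close> and \<open>3 \<le> i \<le> 2n\<close> are kept literally.
\<close>

definition partial :: "'i \<Rightarrow> (('i \<Rightarrow> real) \<Rightarrow> real) \<Rightarrow> ('i \<Rightarrow> real) \<Rightarrow> real" where
  "partial i \<phi> y = deriv (\<lambda>t. \<phi> (y(i := t))) (y i)"

text \<open>
  Locally the sum of a multivariate power series; \<open>k\<close> ranges over the multi-indices in \<open>\<nat>\<^sup>I\<close>, and
  the (unordered) sum is therefore absolutely convergent.
\<close>
definition real_analytic_on ::
    "'i set \<Rightarrow> (('i \<Rightarrow> real) \<Rightarrow> real) \<Rightarrow> ('i \<Rightarrow> real) set \<Rightarrow> bool" where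
  "real_analytic_on I \<phi> U \<longleftrightarrow>
     (\<forall>a\<in>U. \<exists>(c :: ('i \<Rightarrow> nat) \<Rightarrow> real) r. r > 0 \<and>
        (\<forall>y\<in>U. (\<forall>i\<in>I. \<bar>y i - a i\<bar> < r) \<longrightarrow>
           ((\<lambda>k. c k * (\<Prod>i\<in>I. (y i - a i) ^ k i)) has_sum \<phi> y) (extensional I)))"

definition complex_struct :: "nat \<Rightarrow> nat \<Rightarrow> nat \<Rightarrow> real" where
  "complex_struct n j k =
     (if \<exists>i\<in>{1..n}. j = 2*i - 1 \<and> k = 2*i then -1
      else if \<exists>i\<in>{1..n}. j = 2*i \<and> k = 2*i - 1 then 1
      else 0)"

definition mat_sq :: "nat \<Rightarrow> (nat \<Rightarrow> nat \<Rightarrow> real) \<Rightarrow> nat \<Rightarrow> nat \<Rightarrow> real" where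
  "mat_sq n \<alpha> j i = (\<Sum>k=1..2*n. \<alpha> j k * \<alpha> k i)"

definition mu :: "nat \<Rightarrow> ((nat \<Rightarrow> real) \<Rightarrow> real) \<Rightarrow> (nat \<Rightarrow> nat \<Rightarrow> real) \<Rightarrow> nat \<Rightarrow> (nat \<Rightarrow> real) \<Rightarrow> real" where
  "mu n \<rho> \<alpha> i y = (\<Sum>j=1..2*n. partial j \<rho> y * \<alpha> j i)"

definition mu2 :: "nat \<Rightarrow> ((nat \<Rightarrow> real) \<Rightarrow> real) \<Rightarrow> (nat \<Rightarrow> nat \<Rightarrow> real) \<Rightarrow> nat \<Rightarrow> (nat \<Rightarrow> real) \<Rightarrow> real" where
  "mu2 n \<rho> \<alpha> i y = (\<Sum>j=1..2*n. partial j \<rho> y * mat_sq n \<alpha> j i)"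

definition DD :: "nat \<Rightarrow> ((nat \<Rightarrow> real) \<Rightarrow> real) \<Rightarrow> (nat \<Rightarrow> nat \<Rightarrow> real) \<Rightarrow> (nat \<Rightarrow> real) \<Rightarrow> real" where
  "DD n \<rho> \<alpha> y = partial 1 \<rho> y * mu n \<rho> \<alpha> 2 y - partial 2 \<rho> y * mu n \<rho> \<alpha> 1 y"

definition gamma1 :: "nat \<Rightarrow> ((nat \<Rightarrow> real) \<Rightarrow> real) \<Rightarrow> (nat \<Rightarrow> nat \<Rightarrow> real) \<Rightarrow> nat \<Rightarrow> (nat \<Rightarrow> real) \<Rightarrow> real" where
  "gamma1 n \<rho> \<alpha> i y =
     - (1 / DD n \<rho> \<alpha> y) * (partial i \<rho> y * mu n \<rho> \<alpha> 2 y - partial 2 \<rho> y * mu n \<rho> \<alpha> i y)"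

definition gamma2 :: "nat \<Rightarrow> ((nat \<Rightarrow> real) \<Rightarrow> real) \<Rightarrow> (nat \<Rightarrow> nat \<Rightarrow> real) \<Rightarrow> nat \<Rightarrow> (nat \<Rightarrow> real) \<Rightarrow> real" where
  "gamma2 n \<rho> \<alpha> i y =
     - (1 / DD n \<rho> \<alpha> y) * (partial 1 \<rho> y * mu n \<rho> \<alpha> i y - partial i \<rho> y * mu n \<rho> \<alpha> 1 y)"

definition beta :: "nat \<Rightarrow> ((nat \<Rightarrow> real) \<Rightarrow> real) \<Rightarrow> (nat \<Rightarrow> nat \<Rightarrow> real) \<Rightarrow> nat \<Rightarrow> nat \<Rightarrow> (nat \<Rightarrow> real) \<Rightarrow> real" where
  "beta n \<rho> \<alpha> j i y = \<alpha> j 1 * gamma1 n \<rho> \<alpha> i y + \<alpha> j 2 * gamma2 n \<rho> \<alpha> i y + \<alpha> j i"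

definition D0 :: "nat \<Rightarrow> ((nat \<Rightarrow> real) \<Rightarrow> real) \<Rightarrow> (nat \<Rightarrow> nat \<Rightarrow> real) \<Rightarrow> nat \<Rightarrow> (nat \<Rightarrow> real) \<Rightarrow> real" where
  "D0 n \<rho> \<alpha> i y =
     - (1 / (DD n \<rho> \<alpha> y)\<^sup>2) *
       (partial 1 \<rho> y * (mu n \<rho> \<alpha> i y * mu2 n \<rho> \<alpha> 2 y - mu n \<rho> \<alpha> 2 y * mu2 n \<rho> \<alpha> i y)
      + partial 2 \<rho> y * (mu n \<rho> \<alpha> 1 y * mu2 n \<rho> \<alpha> i y - mu n \<rho> \<alpha> i y * mu2 n \<rho> \<alpha> 1 y)
      + partial i \<rho> y * (mu n \<rho> \<alpha> 2 y * mu2 n \<rho> \<alpha> 1 y - mu n \<rho> \<alpha> 1 y * mu2 n \<rho> \<alpha> 2 y))"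

text \<open>\<open>X i\<close>, \<open>F i\<close>, \<open>P i\<close> name the coordinates \<open>x\<^sub>i\<close>, \<open>f\<^sub>i\<close> and \<open>p\<^sup>i\<^sub>1\<close>.\<close>
datatype coord = X nat | F nat | P nat

definition coords :: "nat \<Rightarrow> coord set" where
  "coords n = X ` {1..2} \<union> F ` {1..2*n} \<union> P ` {3..2*n}"

definition xpart :: "(coord \<Rightarrow> real) \<Rightarrow> nat \<Rightarrow> real" where
  "xpart z = (\<lambda>i\<in>{1..2}. z (X i))"

definition fpart :: "nat \<Rightarrow> (coord \<Rightarrow> real) \<Rightarrow> nat \<Rightarrow> real" where
  "fpart n z = (\<lambda>i\<in>{1..2*n}. z (F i))"

definition M_space ::
    "nat \<Rightarrow> ((nat \<Rightarrow> real) \<Rightarrow> real) \<Rightarrow> (nat \<Rightarrow> nat \<Rightarrow> real) \<Rightarrow> (nat \<Rightarrow> real) set \<Rightarrow> (nat \<Rightarrow> real) set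
      \<Rightarrow> (coord \<Rightarrow> real) set" where
  "M_space n \<rho> \<alpha> \<Omega> \<Omega>t =
     {z \<in> extensional (coords n). xpart z \<in> \<Omega> \<and> fpart n z \<in> \<Omega>t \<and> DD n \<rho> \<alpha> (fpart n z) \<noteq> 0}"

text \<open>
  A covector \<open>u\<close> at a point stands for \<open>\<Sum>b. u b dz\<^sub>b\<close>, and an alternating 2-form \<open>w\<close> at a point is
  given by its values \<open>w a b\<close> on the coordinate vectors \<open>\<partial>/\<partial>z\<^sub>a, \<partial>/\<partial>z\<^sub>b\<close>.  Only indices in
  \<^term>\<open>coords n\<close> are relevant.
\<close>
type_synonym covector = "coord \<Rightarrow> real"
type_synonym twoform = "coord \<Rightarrow> coord \<Rightarrow> real"

definition dcoord :: "coord \<Rightarrow> covector" where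
  "dcoord a b = (if a = b then 1 else 0)"

definition wedge :: "covector \<Rightarrow> covector \<Rightarrow> twoform" where
  "wedge u v a b = u a * v b - u b * v a"

text \<open>\<open>d (\<Sum>b. \<omega>\<^sub>b dz\<^sub>b) = \<Sum>a b. (\<partial>\<omega>\<^sub>b/\<partial>z\<^sub>a) dz\<^sub>a \<and> dz\<^sub>b\<close>\<close>
definition ext_d :: "((coord \<Rightarrow> real) \<Rightarrow> covector) \<Rightarrow> (coord \<Rightarrow> real) \<Rightarrow> twoform" where
  "ext_d \<omega> z a b = partial a (\<lambda>w. \<omega> w b) z - partial b (\<lambda>w. \<omega> w a) z"

definition theta ::
    "nat \<Rightarrow> ((nat \<Rightarrow> real) \<Rightarrow> real) \<Rightarrow> (nat \<Rightarrow> nat \<Rightarrow> real) \<Rightarrow> nat \<Rightarrow> (coord \<Rightarrow> real) \<Rightarrow> covector" where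
  "theta n \<rho> \<alpha> k z b =
     dcoord (F k) b
     - (if k = 1 then \<Sum>j=3..2*n. gamma1 n \<rho> \<alpha> j (fpart n z) * z (P j)
        else if k = 2 then \<Sum>j=3..2*n. gamma2 n \<rho> \<alpha> j (fpart n z) * z (P j)
        else z (P k)) * dcoord (X 1) b
     - (\<Sum>j=3..2*n. beta n \<rho> \<alpha> k j (fpart n z) * z (P j)) * dcoord (X 2) b"

text \<open>Congruence of 2-forms at \<open>z\<close> modulo the algebraic ideal generated by \<open>\<theta>\<^sup>1, \<dots>, \<theta>\<^sup>2\<^sup>n\<close>.\<close>
definition cong_theta ::
    "nat \<Rightarrow> ((nat \<Rightarrow> real) \<Rightarrow> real) \<Rightarrow> (nat \<Rightarrow> nat \<Rightarrow> real) \<Rightarrow> (coord \<Rightarrow> real) \<Rightarrow> twoform \<Rightarrow> twoform \<Rightarrow> bool" where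
  "cong_theta n \<rho> \<alpha> z w w' \<longleftrightarrow>
     (\<exists>\<eta> :: nat \<Rightarrow> covector. \<forall>a\<in>coords n. \<forall>b\<in>coords n.
        w a b = w' a b + (\<Sum>l=1..2*n. wedge (\<eta> l) (theta n \<rho> \<alpha> l z) a b))"

definition structure_comb :: "nat \<Rightarrow> (nat \<Rightarrow> real) \<Rightarrow> (nat \<Rightarrow> real) \<Rightarrow> real \<Rightarrow> twoform" where
  "structure_comb n A B c a b =
     (\<Sum>j=3..2*n. A j * wedge (dcoord (P j)) (dcoord (X 1)) a b)
     + (\<Sum>j=3..2*n. B j * wedge (dcoord (P j)) (dcoord (X 2)) a b)
     + c * wedge (dcoord (X 1)) (dcoord (X 2)) a b"

lemma finite_coords: "finite (coords n)" by (simp add: coords_def)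

lemma theta_simp: "\<exists>p q. \<forall>b. theta n \<rho> \<alpha> k z b = dcoord (F k) b - p * dcoord (X 1) b - q * dcoord (X 2) b"
  unfolding theta_def by blast

lemma torsion_exists:
  fixes n k :: nat and z :: "coord \<Rightarrow> real"
  assumes k: "k \<in> {1..2*n}"
  shows "\<exists>c A B. cong_theta n \<rho> \<alpha> z (ext_d (theta n \<rho> \<alpha> k) z) (structure_comb n A B c)"
proof -
  define T1 where "T1 a = partial a (\<lambda>w. theta n \<rho> \<alpha> k w (X 1)) z" for a
  define T2 where "T2 a = partial a (\<lambda>w. theta n \<rho> \<alpha> k w (X 2)) z" for a
  obtain p q where pq: "\<And>l b. theta n \<rho> \<alpha> l z b = dcoord (F l) b - p l * dcoord (X 1) b - q l * dcoord (X 2) b"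
    using theta_simp[of n \<rho> \<alpha> _ z] by metis
  have const: "partial a (\<lambda>w. theta n \<rho> \<alpha> k w b) z = T1 a * dcoord (X 1) b + T2 a * dcoord (X 2) b" for a b
  proof (cases "b = X 1 \<or> b = X 2")
    case True then show ?thesis by (auto simp: T1_def T2_def dcoord_def)
  next
    case False
    then have "(\<lambda>w. theta n \<rho> \<alpha> k w b) = (\<lambda>w. dcoord (F k) b)"
      by (auto simp: theta_def dcoord_def)
    with False show ?thesis by (auto simp: partial_def dcoord_def)
  qed
  have TX: "T1 (X i) = 0" "T2 (X i) = 0" for i
  proof -
    have fp: "fpart n (z(X i := t)) = fpart n z" for t by (simp add: fpart_def)
    have "theta n \<rho> \<alpha> k (z(X i := t)) b = theta n \<rho> \<alpha> k z b" for t b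
      unfolding theta_def fp by simp
    then show "T1 (X i) = 0" "T2 (X i) = 0"
      by (simp_all add: T1_def T2_def partial_def)
  qed
  have dec: "T a = (\<Sum>j=3..2*n. T (P j) * dcoord (P j) a) + (\<Sum>l=1..2*n. T (F l) * dcoord (F l) a)"
    if "a \<in> coords n" "\<And>i. T (X i) = 0" for T a
  proof -
    have s: "(\<Sum>j\<in>J. f j * (if j = i then 1 else 0)) = (if i \<in> J then f i else 0)"
      if "finite J" for J i and f :: "nat \<Rightarrow> real"
      using that by (simp add: if_distrib cong: if_cong)
    show ?thesis using that by (auto simp: coords_def dcoord_def s)
  qed
  define c where "c = (\<Sum>l=1..2*n. T2 (F l) * p l - T1 (F l) * q l)"
  define \<eta> where "\<eta> l b = - T1 (F l) * dcoord (X 1) b - T2 (F l) * dcoord (X 2) b" for l b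
  have "ext_d (theta n \<rho> \<alpha> k) z a b = structure_comb n (T1 \<circ> P) (T2 \<circ> P) c a b
      + (\<Sum>l=1..2*n. wedge (\<eta> l) (theta n \<rho> \<alpha> l z) a b)"
    if ab: "a \<in> coords n" "b \<in> coords n" for a b
  proof -
    let ?x = "\<lambda>i a. dcoord (X i) a"
    have t: "T1 a = (\<Sum>j=3..2*n. T1 (P j) * dcoord (P j) a) + (\<Sum>l=1..2*n. T1 (F l) * dcoord (F l) a)"
      "T2 a = (\<Sum>j=3..2*n. T2 (P j) * dcoord (P j) a) + (\<Sum>l=1..2*n. T2 (F l) * dcoord (F l) a)"
      "T1 b = (\<Sum>j=3..2*n. T1 (P j) * dcoord (P j) b) + (\<Sum>l=1..2*n. T1 (F l) * dcoord (F l) b)"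
      "T2 b = (\<Sum>j=3..2*n. T2 (P j) * dcoord (P j) b) + (\<Sum>l=1..2*n. T2 (F l) * dcoord (F l) b)"
      by (rule dec; use TX ab in simp)+
    have "ext_d (theta n \<rho> \<alpha> k) z a b
       = T1 a * ?x 1 b + T2 a * ?x 2 b - T1 b * ?x 1 a - T2 b * ?x 2 a"
      by (simp add: ext_d_def const)
    also have "\<dots> = structure_comb n (T1 \<circ> P) (T2 \<circ> P) c a b
      + (\<Sum>l=1..2*n. wedge (\<eta> l) (theta n \<rho> \<alpha> l z) a b)"
      unfolding t structure_comb_def wedge_def c_def \<eta>_def pq
      by (simp add: sum_distrib_left sum_distrib_right algebra_simps sum.distrib sum_subtractf sum_negf)
    finally show ?thesis .
  qed
  then show ?thesis unfolding cong_theta_def by blast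
qed

lemma torsion_unique:
  fixes n :: nat and z :: "coord \<Rightarrow> real"
  assumes 1: "cong_theta n \<rho> \<alpha> z w (structure_comb n A B c)"
    and 2: "cong_theta n \<rho> \<alpha> z w (structure_comb n A' B' c')"
  shows "c = c'"
proof -
  obtain p q where pq: "\<And>l b. theta n \<rho> \<alpha> l z b = dcoord (F l) b - p l * dcoord (X 1) b - q l * dcoord (X 2) b"
    using theta_simp[of n \<rho> \<alpha> _ z] by metis
  define C where "C = coords n"
  have fin: "finite C" by (simp add: C_def finite_coords)
  define e1 :: covector where "e1 a = (case a of X i \<Rightarrow> if i = 1 then 1 else 0 | F l \<Rightarrow> p l | P j \<Rightarrow> 0)" for a
  define e2 :: covector where "e2 a = (case a of X i \<Rightarrow> if i = 2 then 1 else 0 | F l \<Rightarrow> q l | P j \<Rightarrow> 0)" for a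
  define ap :: "covector \<Rightarrow> covector \<Rightarrow> real" where "ap u e = (\<Sum>a\<in>C. u a * e a)" for u e
  define ev where "ev w = (\<Sum>a\<in>C. \<Sum>b\<in>C. w a b * e1 a * e2 b)" for w :: twoform
  have ev_wedge: "ev (wedge u v) = ap u e1 * ap v e2 - ap u e2 * ap v e1" for u v
  proof -
    have "ev (wedge u v) = (\<Sum>a\<in>C. \<Sum>b\<in>C. (u a * e1 a) * (v b * e2 b)) - (\<Sum>a\<in>C. \<Sum>b\<in>C. (v a * e1 a) * (u b * e2 b))"
      by (simp add: ev_def wedge_def algebra_simps sum_subtractf)
    then show ?thesis by (simp add: ap_def sum_product mult.commute)
  qed
  have ap_d: "ap (dcoord x) e = (if x \<in> C then e x else 0)" for x e
    using fin by (simp add: ap_def dcoord_def if_distrib[of "\<lambda>t. t * _"] cong: if_cong)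
  have apt: "ap (theta n \<rho> \<alpha> l z) e = ap (dcoord (F l)) e - p l * ap (dcoord (X 1)) e - q l * ap (dcoord (X 2)) e" for l e
    by (simp add: pq ap_def algebra_simps sum_subtractf sum_distrib_left sum.distrib)
  have X: "X 1 \<in> C" "X 2 \<in> C" by (auto simp: C_def coords_def)
  have th0: "ap (theta n \<rho> \<alpha> l z) e1 = 0" "ap (theta n \<rho> \<alpha> l z) e2 = 0" if "l \<in> {1..2*n}" for l
    using that X unfolding apt ap_d by (auto simp: C_def coords_def e1_def e2_def)
  have ev_add: "ev (\<lambda>a b. f a b + g a b) = ev f + ev g" for f g
    by (simp add: ev_def algebra_simps sum.distrib)
  have ev_scale: "ev (\<lambda>a b. r * f a b) = r * ev f" for f r
    by (simp add: ev_def algebra_simps sum_distrib_left)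
  have ev_sum: "ev (\<lambda>a b. \<Sum>l\<in>L. f l a b) = (\<Sum>l\<in>L. ev (f l))" for f and L :: "nat set"
  proof (cases "finite L")
    case True then show ?thesis
      by (induction L) (simp_all add: ev_add, simp add: ev_def)
  qed (simp add: ev_def)
  have P0: "ap (dcoord (P j)) e1 = 0" "ap (dcoord (P j)) e2 = 0" for j
    by (simp_all add: ap_d e1_def e2_def)
  have ev_sc: "ev (structure_comb n A B c) = c" for A B c
    unfolding structure_comb_def ev_add ev_sum ev_scale ev_wedge P0
    using X by (simp add: ap_d e1_def e2_def)
  have "ev w = c" if cg: "cong_theta n \<rho> \<alpha> z w (structure_comb n A B c)" for A B c
  proof -
    obtain \<eta> where \<eta>: "\<And>a b. a \<in> C \<Longrightarrow> b \<in> C \<Longrightarrow> w a b = structure_comb n A B c a b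
        + (\<Sum>l=1..2*n. wedge (\<eta> l) (theta n \<rho> \<alpha> l z) a b)"
      using cg unfolding cong_theta_def C_def by blast
    have "ev w = ev (\<lambda>a b. structure_comb n A B c a b + (\<Sum>l=1..2*n. wedge (\<eta> l) (theta n \<rho> \<alpha> l z) a b))"
      by (simp add: ev_def \<eta>)
    also have "\<dots> = c"
      unfolding ev_add ev_sum ev_sc ev_wedge by (simp add: th0)
    finally show ?thesis .
  qed
  with 1 2 show ?thesis by blast
qed

text \<open>The coefficient of \<open>dx\<^sub>1 \<and> dx\<^sub>2\<close> in \<open>d\<theta>\<^sup>k\<close> modulo the \<open>\<theta>\<^sup>l\<close> is well defined.\<close>
lemma torsion_ex1:
  assumes "k \<in> {1..2*n}"
  shows "\<exists>!c. \<exists>A B. cong_theta n \<rho> \<alpha> z (ext_d (theta n \<rho> \<alpha> k) z) (structure_comb n A B c)"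
  using torsion_exists[OF assms, of \<rho> \<alpha> z] torsion_unique by blast

definition torsion ::
    "nat \<Rightarrow> ((nat \<Rightarrow> real) \<Rightarrow> real) \<Rightarrow> (nat \<Rightarrow> nat \<Rightarrow> real) \<Rightarrow> nat \<Rightarrow> (coord \<Rightarrow> real) \<Rightarrow> real" where
  "torsion n \<rho> \<alpha> k z =
     (THE c. \<exists>A B. cong_theta n \<rho> \<alpha> z (ext_d (theta n \<rho> \<alpha> k) z) (structure_comb n A B c))"

definition torsion_absorbable ::
    "nat \<Rightarrow> ((nat \<Rightarrow> real) \<Rightarrow> real) \<Rightarrow> (nat \<Rightarrow> nat \<Rightarrow> real) \<Rightarrow> (coord \<Rightarrow> real) \<Rightarrow> bool" where
  "torsion_absorbable n \<rho> \<alpha> z \<longleftrightarrow>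
     (\<exists>v1 v2 :: nat \<Rightarrow> real.
        (\<Sum>i=3..2*n. gamma1 n \<rho> \<alpha> i (fpart n z) * v2 i - beta n \<rho> \<alpha> 1 i (fpart n z) * v1 i)
          = torsion n \<rho> \<alpha> 1 z \<and>
        (\<Sum>i=3..2*n. gamma2 n \<rho> \<alpha> i (fpart n z) * v2 i - beta n \<rho> \<alpha> 2 i (fpart n z) * v1 i)
          = torsion n \<rho> \<alpha> 2 z \<and>
        (\<forall>j\<in>{3..2*n}.
           v2 j - (\<Sum>i=3..2*n. beta n \<rho> \<alpha> j i (fpart n z) * v1 i) = torsion n \<rho> \<alpha> j z))"

end

theory Submission
  imports Defs
begin

text \<open>
  Write \<open>\<alpha>\<close> for the matrix of the complex structure.

  The equality \<open>\<DD>\<^sub>0 = 0\<close> comes from \<open>\<alpha>\<^sup>2 = -1\<close> alone: it gives \<open>\<mu>\<^sup>(\<^sup>2\<^sup>) = -\<rho>'\<close>, and the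
  expression in braces that defines \<open>\<DD>\<^sub>0\<^sub>,\<^sub>i\<close> is, up to sign, the determinant with rows
  \<open>\<rho>'\<close>, \<open>\<mu>\<close>, \<open>\<mu>\<^sup>(\<^sup>2\<^sup>)\<close> and columns \<open>1, 2, i\<close>, two of whose rows are now proportional.

  The absorption of the torsion rests on the block form of \<open>\<alpha>\<close>: the rows \<open>k \<ge> 3\<close> have zeros in
  columns \<open>1\<close> and \<open>2\<close>.  Hence \<open>\<beta>\<^sub>k\<^sub>,\<^sub>i = \<alpha>\<^sub>k\<^sub>,\<^sub>i\<close> is constant, so \<open>\<theta>\<^sup>k\<close> has coefficients that depend
  on the \<open>p\<close> coordinates only, and \<open>d\<theta>\<^sup>k\<close> consists of \<open>dp \<and> dx\<close> terms without any reduction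
  modulo the \<open>\<theta>\<^sup>l\<close>.  Thus \<open>c\<^sup>k\<^sub>1\<^sub>2 = 0\<close> for every \<open>k \<ge> 3\<close>.  If \<open>c\<^sup>1\<^sub>1\<^sub>2\<close> and \<open>c\<^sup>2\<^sub>1\<^sub>2\<close> vanish too, the
  absorption equations are homogeneous and \<open>v = 0\<close> solves them.
\<close>

lemma complex_struct_row:
  assumes "j \<in> {1..2*n}"
  shows "complex_struct n j k =
    (if odd j then if k = j + 1 then -1 else 0 else if k + 1 = j then 1 else 0)"
proof -
  have "(\<exists>i\<in>{1..n}. j = 2*i - 1 \<and> k = 2*i) \<longleftrightarrow> odd j \<and> k = j + 1"
  proof
    assume "odd j \<and> k = j + 1"
    moreover from this obtain m where "j = 2*m + 1" by (auto elim: oddE)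
    ultimately show "\<exists>i\<in>{1..n}. j = 2*i - 1 \<and> k = 2*i"
      using assms by (intro bexI[of _ "m + 1"]) auto
  qed auto
  moreover have "(\<exists>i\<in>{1..n}. j = 2*i \<and> k = 2*i - 1) \<longleftrightarrow> even j \<and> k + 1 = j"
  proof
    assume "even j \<and> k + 1 = j"
    moreover from this obtain m where "j = 2*m" by (auto elim: evenE)
    ultimately show "\<exists>i\<in>{1..n}. j = 2*i \<and> k = 2*i - 1"
      using assms by (intro bexI[of _ m]) auto
  qed auto
  ultimately show ?thesis by (simp add: complex_struct_def)
qed

lemma mat_sq_complex_struct:
  assumes "j \<in> {1..2*n}"
  shows "mat_sq n (complex_struct n) j i = (if j = i then -1 else 0)"
proof (cases "odd j")
  case True
  with assms have mem: "j + 1 \<in> {1..2*n}" by auto presburger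
  have "mat_sq n (complex_struct n) j i
      = (\<Sum>k=1..2*n. if k = j + 1 then - complex_struct n (j + 1) i else 0)"
    unfolding mat_sq_def using True by (intro sum.cong) (auto simp: complex_struct_row[OF assms])
  with mem True show ?thesis
    using complex_struct_row[OF mem, of i] by simp
next
  case False
  with assms have mem: "j - 1 \<in> {1..2*n}" by auto
  have "mat_sq n (complex_struct n) j i
      = (\<Sum>k=1..2*n. if k = j - 1 then complex_struct n (j - 1) i else 0)"
    unfolding mat_sq_def using False by (intro sum.cong) (auto simp: complex_struct_row[OF assms])
  with mem False assms show ?thesis
    using complex_struct_row[OF mem, of i] by auto
qed

lemma mu_complex_struct:
  assumes "n \<ge> 1"
  shows "mu n \<rho> (complex_struct n) 1 y = partial 2 \<rho> y"
    and "mu n \<rho> (complex_struct n) 2 y = - partial 1 \<rho> y"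
proof -
  have "mu n \<rho> (complex_struct n) 1 y = (\<Sum>j=1..2*n. if j = 2 then partial 2 \<rho> y else 0)"
    unfolding mu_def by (intro sum.cong) (auto simp: complex_struct_row)
  then show "mu n \<rho> (complex_struct n) 1 y = partial 2 \<rho> y" using assms by simp
  have "mu n \<rho> (complex_struct n) 2 y = (\<Sum>j=1..2*n. if j = 1 then - partial 1 \<rho> y else 0)"
    unfolding mu_def by (intro sum.cong) (auto simp: complex_struct_row)
  then show "mu n \<rho> (complex_struct n) 2 y = - partial 1 \<rho> y" using assms by simp
qed

lemma mu2_scalar_square:
  assumes sq: "\<And>j i. j \<in> {1..2*n} \<Longrightarrow> i \<in> {1..2*n} \<Longrightarrow> mat_sq n \<alpha> j i = (if j = i then s else 0)"
    and i: "i \<in> {1..2*n}"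
  shows "mu2 n \<rho> \<alpha> i y = s * partial i \<rho> y"
proof -
  have "mu2 n \<rho> \<alpha> i y = (\<Sum>j=1..2*n. if j = i then s * partial i \<rho> y else 0)"
    unfolding mu2_def using i by (intro sum.cong) (auto simp: sq)
  with i show ?thesis by simp
qed

text \<open>
  A matrix with scalar square makes \<open>\<mu>\<^sup>(\<^sup>2\<^sup>)\<close> a multiple of the gradient of \<open>\<rho>\<close>, so two rows of the
  determinant behind \<open>\<DD>\<^sub>0\<close> are proportional.
\<close>
lemma D0_eq_0_scalar_square:
  assumes sq: "\<And>j i. j \<in> {1..2*n} \<Longrightarrow> i \<in> {1..2*n} \<Longrightarrow> mat_sq n \<alpha> j i = (if j = i then s else 0)"
    and n: "n \<ge> 1" and i: "i \<in> {1..2*n}"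
  shows "D0 n \<rho> \<alpha> i y = 0"
proof -
  have "mu2 n \<rho> \<alpha> l y = s * partial l \<rho> y" if "l \<in> {1, 2, i}" for l
    using that n i by (intro mu2_scalar_square sq) auto
  then show ?thesis by (simp add: D0_def algebra_simps)
qed

lemma partial_linear:
  assumes "finite J"
  shows "partial a (\<lambda>w. r + (\<Sum>j\<in>J. m j * w (x j))) z = (\<Sum>j\<in>J. m j * dcoord (x j) a)"
proof -
  have d: "((\<lambda>t. (z(a := t)) c) has_field_derivative dcoord c a) (at (z a))" for c
    by (cases "c = a") (auto simp: dcoord_def intro!: derivative_eq_intros)
  show ?thesis
    unfolding partial_def
    by (intro DERIV_imp_deriv) (auto intro!: derivative_eq_intros d simp: mult.commute simp del: fun_upd_apply)
qed

text \<open>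
  The two zero entries remove \<open>\<gamma>\<^sup>1\<close> and \<open>\<gamma>\<^sup>2\<close>, the only carriers of \<open>f\<close>, from \<open>\<theta>\<^sup>k\<close>.  So
  \<open>d\<theta>\<^sup>k = - dp\<^sup>k \<and> dx\<^sub>1 - \<Sum>\<^sub>j \<alpha>\<^sub>k\<^sub>j dp\<^sup>j \<and> dx\<^sub>2\<close> holds exactly, which exhibits \<open>0\<close> as a coefficient
  of \<open>dx\<^sub>1 \<and> dx\<^sub>2\<close>; by uniqueness modulo the \<open>\<theta>\<^sup>l\<close> it is the torsion.
\<close>
lemma torsion_eq_0_constant_beta:
  assumes k: "k \<in> {3..2*n}" and zero: "\<alpha> k 1 = 0" "\<alpha> k 2 = 0"
  shows "torsion n \<rho> \<alpha> k z = 0"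
proof -
  let ?A = "\<lambda>j. if j = k then - 1 else 0 :: real"
  let ?B = "\<lambda>j. - \<alpha> k j"
  have \<beta>: "beta n \<rho> \<alpha> k j y = \<alpha> k j" for j y
    using zero by (simp add: beta_def)
  have d\<theta>: "partial a (\<lambda>w. theta n \<rho> \<alpha> k w b) z
      = (\<Sum>j=3..2*n. ?A j * dcoord (P j) a) * dcoord (X 1) b
      + (\<Sum>j=3..2*n. ?B j * dcoord (P j) a) * dcoord (X 2) b" for a b
  proof -
    let ?m = "\<lambda>j. ?A j * dcoord (X 1) b + ?B j * dcoord (X 2) b"
    have "theta n \<rho> \<alpha> k w b = dcoord (F k) b + (\<Sum>j=3..2*n. ?m j * w (P j))" for w
    proof -
      have "(\<Sum>j=3..2*n. ?m j * w (P j)) =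
          (\<Sum>j=3..2*n. if j = k then - w (P k) * dcoord (X 1) b else 0)
          - (\<Sum>j=3..2*n. \<alpha> k j * w (P j)) * dcoord (X 2) b"
        unfolding sum_distrib_right sum_subtractf[symmetric]
        by (intro sum.cong) (auto simp: algebra_simps)
      with k show ?thesis by (simp add: theta_def \<beta>)
    qed
    then have "partial a (\<lambda>w. theta n \<rho> \<alpha> k w b) z = (\<Sum>j=3..2*n. ?m j * dcoord (P j) a)"
      by (simp only: partial_linear finite_atLeastAtMost)
    also have "\<dots> = (\<Sum>j=3..2*n. ?A j * dcoord (P j) a) * dcoord (X 1) b
      + (\<Sum>j=3..2*n. ?B j * dcoord (P j) a) * dcoord (X 2) b"
      unfolding sum_distrib_right sum.distrib[symmetric]
      by (intro sum.cong) (auto simp: algebra_simps)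
    finally show ?thesis .
  qed
  have "ext_d (theta n \<rho> \<alpha> k) z a b = structure_comb n ?A ?B 0 a b" for a b
    unfolding ext_d_def d\<theta> structure_comb_def wedge_def sum_distrib_right
      right_diff_distrib sum_subtractf mult.assoc
    by (simp add: mult.commute)
  then have "cong_theta n \<rho> \<alpha> z (ext_d (theta n \<rho> \<alpha> k) z) (structure_comb n ?A ?B 0)"
    unfolding cong_theta_def by (intro exI[of _ "\<lambda>_ _. 0"]) (simp add: wedge_def)
  then show ?thesis
    unfolding torsion_def by (intro the_equality) (blast dest: torsion_unique)+
qed

lemma torsion_absorbable_if_0:
  assumes "\<And>k. k \<in> {1..2*n} \<Longrightarrow> torsion n \<rho> \<alpha> k z = 0" and "n \<ge> 1"
  shows "torsion_absorbable n \<rho> \<alpha> z"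
  unfolding torsion_absorbable_def using assms by (intro exI[of _ "\<lambda>_. 0"]) auto

theorem corollary3p7:
  fixes n :: nat
    and \<rho> :: "(nat \<Rightarrow> real) \<Rightarrow> real"
    and \<Omega> \<Omega>t :: "(nat \<Rightarrow> real) set"
    and z :: "coord \<Rightarrow> real"
  assumes "n \<ge> 2"
    and "openin (powertop_real {1..2}) \<Omega>"
    and "openin (powertop_real {1..2*n}) \<Omega>t"
    and "real_analytic_on {1..2*n} \<rho> \<Omega>t"
    and "z \<in> M_space n \<rho> (complex_struct n) \<Omega> \<Omega>t"
  shows "DD n \<rho> (complex_struct n) (fpart n z)
           = - ((partial 1 \<rho> (fpart n z))\<^sup>2 + (partial 2 \<rho> (fpart n z))\<^sup>2)
       \<and> (\<forall>i\<in>{3..2*n}. D0 n \<rho> (complex_struct n) i (fpart n z) = 0)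
       \<and> (torsion n \<rho> (complex_struct n) 1 z = 0 \<and> torsion n \<rho> (complex_struct n) 2 z = 0
            \<longrightarrow> torsion_absorbable n \<rho> (complex_struct n) z)"
proof (intro conjI ballI impI)
  let ?\<alpha> = "complex_struct n" and ?y = "fpart n z"
  have n: "n \<ge> 1" using assms(1) by simp
  show "DD n \<rho> ?\<alpha> ?y = - ((partial 1 \<rho> ?y)\<^sup>2 + (partial 2 \<rho> ?y)\<^sup>2)"
    by (simp only: DD_def mu_complex_struct[OF n]) (simp add: power2_eq_square)
  show "D0 n \<rho> ?\<alpha> i ?y = 0" if "i \<in> {3..2*n}" for i
    using that n by (intro D0_eq_0_scalar_square[where s = "-1"] mat_sq_complex_struct) auto
  assume c: "torsion n \<rho> ?\<alpha> 1 z = 0 \<and> torsion n \<rho> ?\<alpha> 2 z = 0"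
  show "torsion_absorbable n \<rho> ?\<alpha> z"
  proof (rule torsion_absorbable_if_0[OF _ n])
    fix k assume k: "k \<in> {1..2*n}"
    show "torsion n \<rho> ?\<alpha> k z = 0"
    proof (cases "k \<in> {1, 2}")
      case True
      with c show ?thesis by auto
    next
      case False
      with k have "k \<in> {3..2*n}" by auto
      moreover from this have "?\<alpha> k 1 = 0" "?\<alpha> k 2 = 0"
        by (auto simp: complex_struct_row[OF k])
      ultimately show ?thesis by (rule torsion_eq_0_constant_beta)
    qed
  qed
qed

end
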